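(* Let $H$ be a real Hilbert space, and let $A$ be a self-adjoint operator on $H$ with domain $D(A)$ such that there exist an orthonormal basis $\{e_i\}_{i\ge 1}$ of $H$ and a nondecreasing sequence $\{\lambda_i\}_{i\ge 1}$ of positive real numbers with $\lambda_i\to+\infty$ and $Ae_i=\lambda_i^2e_i$ for every $i\ge 1$. Then for every pair $(u_0,u_1)\in D(A^{1/2})\times H$ there exist two pairs $(v_0,v_1)$ and $(w_0,w_1)$ in $\mathcal{SG}(A)$ such that $u_0=v_0+w_0$ and $u_1=v_1+w_1$.
   Context: Here $\langle\cdot,\cdot\rangle$ denotes the scalar product of $H$. The space $D(A^{1/2})$ is the set of all $v\in H$ with $\sum_{i\ge1}\lambda_i^2\langle v,e_i\rangle^2<+\infty$. Lacunary data: for every $(u_0,u_1)\in D(A^{1/2})\times H$ and every positive integer $k$, set $$R_k(u_0,u_1):=\sum_{i=k+1}^{\infty}\left(\langle u_1,e_i\rangle^2+\lambda_i^2\langle u_0,e_i\rangle^2\right).$$ $\mathcal{SG}(A)$ denotes the set of all pairs $(u_0,u_1)\in D(A^{1/2})\times H$ such that $$R_k(u_0,u_1)\cdot k^2\exp(k\lambda_k)\le 1\qquad\text{for infinitely many integers }k\ge 1$$ (the set of such $k$ may depend on $(u_0,u_1)$). *)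

theory Defs
  imports "HOL-Analysis.Analysis"
begin

text \<open>
  A possibly unbounded operator on a Hilbert space is a pair of a domain \<open>D\<close> and a
  function \<open>A\<close> whose values outside \<open>D\<close> are irrelevant.  All sequences are indexed from 1;
  their values at index 0 are irrelevant.
\<close>

definition linear_op_on :: "'a::real_vector set \<Rightarrow> ('a \<Rightarrow> 'a) \<Rightarrow> bool" where
  "linear_op_on D A \<longleftrightarrow> subspace D \<and>
     (\<forall>x\<in>D. \<forall>y\<in>D. A (x + y) = A x + A y) \<and> (\<forall>c. \<forall>x\<in>D. A (c *\<^sub>R x) = c *\<^sub>R A x)"

definition adjoint_graph :: "'a::real_inner set \<Rightarrow> ('a \<Rightarrow> 'a) \<Rightarrow> ('a \<times> 'a) set" where
  "adjoint_graph D A = {(y, z). \<forall>x\<in>D. A x \<bullet> y = x \<bullet> z}"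

text \<open>Equality of graphs includes equality of the domains of the operator and its adjoint.\<close>

definition selfadjoint_op :: "'a::real_inner set \<Rightarrow> ('a \<Rightarrow> 'a) \<Rightarrow> bool" where
  "selfadjoint_op D A \<longleftrightarrow>
     linear_op_on D A \<and> closure D = UNIV \<and> adjoint_graph D A = {(x, A x) |x. x \<in> D}"

definition orthonormal_basis :: "(nat \<Rightarrow> 'a::real_inner) \<Rightarrow> bool" where
  "orthonormal_basis e \<longleftrightarrow>
     (\<forall>i\<ge>1. \<forall>j\<ge>1. e i \<bullet> e j = (if i = j then 1 else 0)) \<and>
     closure (span (e ` {1..})) = UNIV"

text \<open>
  The domain of the square root of the operator with eigenvectors \<open>e i\<close> and eigenvalues
  \<open>(lam i)\<^sup>2\<close>; the operator enters the following notions only through \<open>e\<close> and \<open>lam\<close>.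
\<close>

definition dom_sqrt :: "(nat \<Rightarrow> 'a::real_inner) \<Rightarrow> (nat \<Rightarrow> real) \<Rightarrow> 'a set" where
  "dom_sqrt e lam = {v. (\<lambda>i. (lam i)\<^sup>2 * (v \<bullet> e i)\<^sup>2) summable_on {1..}}"

text \<open>For \<open>u0 \<in> dom_sqrt e lam\<close> and orthonormal \<open>e\<close> the following series converges.\<close>

definition remainder ::
    "(nat \<Rightarrow> 'a::real_inner) \<Rightarrow> (nat \<Rightarrow> real) \<Rightarrow> nat \<Rightarrow> 'a \<Rightarrow> 'a \<Rightarrow> real" where
  "remainder e lam k u0 u1 =
     (\<Sum>\<^sub>\<infinity>i\<in>{k+1..}. (u1 \<bullet> e i)\<^sup>2 + (lam i)\<^sup>2 * (u0 \<bullet> e i)\<^sup>2)"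

definition SG :: "(nat \<Rightarrow> 'a::real_inner) \<Rightarrow> (nat \<Rightarrow> real) \<Rightarrow> ('a \<times> 'a) set" where
  "SG e lam = {(u0, u1). u0 \<in> dom_sqrt e lam \<and>
     infinite {k. k \<ge> 1 \<and>
       remainder e lam k u0 u1 * ((real k)\<^sup>2 * exp (real k * lam k)) \<le> 1}}"

end

theory Submission
  imports Defs
begin

text \<open>
  The energy of \<open>(u0, u1)\<close> splits over the indices \<open>i\<close> into the summable terms
  \<open>(u1 \<bullet> e i)\<^sup>2 + (lam i)\<^sup>2 * (u0 \<bullet> e i)\<^sup>2\<close>, so its tails tend to \<open>0\<close>
  (\<open>infsum_tail_small\<close>), whereas membership in \<open>SG\<close> asks for a small remainder along a mere
  subsequence. Choose cut points \<open>f 0 < f 1 < \<dots>\<close> growing so fast that the energy of the data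
  above \<open>f (n + 1)\<close> is already below the bound that \<open>SG\<close> imposes at \<open>f n\<close>
  (\<open>rapid_cut_points\<close>), and cut the indices into the blocks \<open>{f n<..f (n + 1)}\<close>. If a pair
  keeps only some Fourier coefficients of the data and has none in the \<open>n\<close>-th block, then its
  remainder at \<open>f n\<close> is a remainder at \<open>f (n + 1)\<close>, so the bound holds at \<open>k = f n\<close>. Give
  the coefficients of the even blocks to \<open>v\<close> and all others to \<open>w\<close>: then \<open>v\<close> has a gap at
  every odd block and \<open>w\<close> at every even one, so both lie in \<open>SG\<close> (\<open>SG_if_block_gaps\<close>).

  The pair \<open>v\<close> exists because square-summable coefficients define a vector of the complete
  space (\<open>coefficient_truncation_exists\<close>), and \<open>w\<close> is obtained by subtraction.
\<close>

section \<open>Tails and Fourier coefficients\<close>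

lemma infsum_tail_small:
  fixes a :: "nat \<Rightarrow> real"
  assumes sm: "a summable_on {1..}" and nn: "\<And>i. i \<ge> 1 \<Longrightarrow> 0 \<le> a i" and "0 < \<epsilon>"
  shows "\<exists>m. \<forall>k\<ge>m. infsum a {k+1..} \<le> \<epsilon>"
proof -
  obtain F where F: "finite F" "F \<subseteq> {1..}" "dist (sum a F) (infsum a {1..}) \<le> \<epsilon>"
    using infsum_finite_approximation[OF sm \<open>0 < \<epsilon>\<close>] by blast
  have "infsum a {k+1..} \<le> \<epsilon>" if k: "k \<ge> Max (insert 0 F)" for k
  proof -
    have Fk: "F \<subseteq> {1..k}"
      using F k by (auto simp: subset_iff)
    have tail: "a summable_on {k+1..}"
      by (rule summable_on_subset_banach[OF sm]) auto
    have "{1..} = {1..k} \<union> {k+1..}" by auto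
    then have "infsum a {1..} = infsum a ({1..k} \<union> {k+1..})" by simp
    also have "\<dots> = infsum a {1..k} + infsum a {k+1..}"
      by (rule infsum_Un_disjoint) (use tail in auto)
    finally have "infsum a {1..} = sum a {1..k} + infsum a {k+1..}" by simp
    moreover have "sum a F \<le> sum a {1..k}"
      by (rule sum_mono2) (use Fk nn in auto)
    ultimately show ?thesis
      using F(3) by (simp add: dist_real_def)
  qed
  then show ?thesis by blast
qed

lemma norm_sum_orthonormal:
  fixes e :: "nat \<Rightarrow> 'a::real_inner"
  assumes on: "\<And>i j. i \<ge> 1 \<Longrightarrow> j \<ge> 1 \<Longrightarrow> e i \<bullet> e j = (if i = j then 1 else 0)"
    and F: "finite F" "F \<subseteq> {1..}"
  shows "(norm (\<Sum>i\<in>F. c i *\<^sub>R e i))\<^sup>2 = (\<Sum>i\<in>F. (c i)\<^sup>2)"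
proof -
  have "(norm (\<Sum>i\<in>F. c i *\<^sub>R e i))\<^sup>2 = (\<Sum>i\<in>F. (norm (c i *\<^sub>R e i))\<^sup>2)"
    by (rule norm_sum_Pythagorean[OF F(1)])
      (use F on in \<open>auto simp: pairwise_def orthogonal_def subset_iff\<close>)
  also have "\<dots> = (\<Sum>i\<in>F. (c i)\<^sup>2)"
    by (rule sum.cong) (use F on in \<open>auto simp: power_mult_distrib power2_norm_eq_inner subset_iff\<close>)
  finally show ?thesis .
qed

lemma inner_sum_orthonormal:
  fixes e :: "nat \<Rightarrow> 'a::real_inner"
  assumes on: "\<And>i j. i \<ge> 1 \<Longrightarrow> j \<ge> 1 \<Longrightarrow> e i \<bullet> e j = (if i = j then 1 else 0)"
    and F: "finite F" "F \<subseteq> {1..}" and "j \<ge> 1"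
  shows "(\<Sum>i\<in>F. c i *\<^sub>R e i) \<bullet> e j = (if j \<in> F then c j else 0)"
proof -
  have "(\<Sum>i\<in>F. c i *\<^sub>R e i) \<bullet> e j = (\<Sum>i\<in>F. if j = i then c i else 0)"
    unfolding inner_sum_left
    by (rule sum.cong) (use F on \<open>j \<ge> 1\<close> in \<open>auto simp: subset_iff\<close>)
  then show ?thesis using F(1) by simp
qed

text \<open>
  Bessel's inequality: a partial Fourier sum of \<open>u\<close> is orthogonal to the rest of \<open>u\<close>, so the
  squared norm of the sum is at most that of \<open>u\<close>.
\<close>

lemma fourier_coefficients_square_summable:
  fixes e :: "nat \<Rightarrow> 'a::real_inner"
  assumes on: "\<And>i j. i \<ge> 1 \<Longrightarrow> j \<ge> 1 \<Longrightarrow> e i \<bullet> e j = (if i = j then 1 else 0)"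
  shows "(\<lambda>i. (u \<bullet> e i)\<^sup>2) summable_on {1..}"
proof (rule nonneg_bdd_above_summable_on)
  have "(\<Sum>i\<in>F. (u \<bullet> e i)\<^sup>2) \<le> (norm u)\<^sup>2" if F: "F \<subseteq> {1..}" "finite F" for F
  proof -
    define p where "p = (\<Sum>i\<in>F. (u \<bullet> e i) *\<^sub>R e i)"
    have pp: "p \<bullet> p = (\<Sum>i\<in>F. (u \<bullet> e i)\<^sup>2)"
      using norm_sum_orthonormal[OF on F(2,1)] by (simp add: p_def power2_norm_eq_inner)
    have up: "u \<bullet> p = (\<Sum>i\<in>F. (u \<bullet> e i)\<^sup>2)"
      by (simp add: p_def inner_sum_right power2_eq_square)
    have "0 \<le> (u - p) \<bullet> (u - p)" by simp
    also have "\<dots> = u \<bullet> u - p \<bullet> p"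
      using pp up by (simp add: inner_diff_left inner_diff_right inner_commute)
    finally show ?thesis using pp by (simp add: power2_norm_eq_inner)
  qed
  then show "bdd_above (sum (\<lambda>i. (u \<bullet> e i)\<^sup>2) ` {F. F \<subseteq> {1..} \<and> finite F})"
    by (auto intro!: bdd_aboveI)
qed simp

text \<open>
  The truncated Fourier series converges, since the squared norm of a stretch of it is at most a
  tail of the convergent series of squared coefficients.
\<close>

lemma coefficient_truncation_exists:
  fixes e :: "nat \<Rightarrow> 'a::{real_inner, complete_space}"
  assumes on: "\<And>i j. i \<ge> 1 \<Longrightarrow> j \<ge> 1 \<Longrightarrow> e i \<bullet> e j = (if i = j then 1 else 0)"
  shows "\<exists>v. \<forall>j\<ge>1. v \<bullet> e j = (if j \<in> S then u \<bullet> e j else 0)"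
proof -
  let ?c = "\<lambda>i. u \<bullet> e i"
  define s where "s n = (\<Sum>i\<in>S \<inter> {1..n}. ?c i *\<^sub>R e i)" for n
  note sq = fourier_coefficients_square_summable[OF on, where u = u]
  have "Cauchy s"
  proof (rule CauchyI')
    fix \<epsilon> :: real assume "0 < \<epsilon>"
    then have "0 < \<epsilon>\<^sup>2 / 2" by simp
    then obtain M where M: "\<And>k. k \<ge> M \<Longrightarrow> infsum (\<lambda>i. (?c i)\<^sup>2) {k+1..} \<le> \<epsilon>\<^sup>2 / 2"
      using infsum_tail_small[OF sq, of "\<epsilon>\<^sup>2 / 2"] by (metis zero_le_power2)
    have "norm (s m - s n) < \<epsilon>" if "m \<ge> M" "n > m" for m n
    proof -
      have "S \<inter> {1..n} = (S \<inter> {1..m}) \<union> (S \<inter> {m+1..n})"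
        using \<open>n > m\<close> by auto
      then have "s n = s m + (\<Sum>i\<in>S \<inter> {m+1..n}. ?c i *\<^sub>R e i)"
        unfolding s_def by (simp, subst sum.union_disjoint) auto
      then have "(norm (s m - s n))\<^sup>2 = (norm (\<Sum>i\<in>S \<inter> {m+1..n}. ?c i *\<^sub>R e i))\<^sup>2"
        by simp
      also have "\<dots> = (\<Sum>i\<in>S \<inter> {m+1..n}. (?c i)\<^sup>2)"
        by (rule norm_sum_orthonormal[OF on]) auto
      also have "\<dots> \<le> infsum (\<lambda>i. (?c i)\<^sup>2) {m+1..}"
        by (rule finite_sum_le_infsum)
          (auto intro: summable_on_subset_banach[OF sq])
      also have "\<dots> < \<epsilon>\<^sup>2"
        using M[OF \<open>m \<ge> M\<close>] \<open>0 < \<epsilon>\<^sup>2 / 2\<close> by linarith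
      finally show ?thesis
        using \<open>0 < \<epsilon>\<close> power2_less_imp_less by fastforce
    qed
    then show "\<exists>M. \<forall>m\<ge>M. \<forall>n>m. dist (s m) (s n) < \<epsilon>"
      unfolding dist_norm by blast
  qed
  then obtain v where v: "s \<longlonglongrightarrow> v"
    by (auto simp: Cauchy_convergent_iff convergent_def)
  have "v \<bullet> e j = (if j \<in> S then ?c j else 0)" if "j \<ge> 1" for j
  proof -
    have limit_inner: "(\<lambda>n. s n \<bullet> e j) \<longlonglongrightarrow> v \<bullet> e j"
      by (intro tendsto_intros v)
    have "s n \<bullet> e j = (if j \<in> S then ?c j else 0)" if "n \<ge> j" for n
      unfolding s_def
      by (subst inner_sum_orthonormal[OF on]) (use \<open>j \<ge> 1\<close> \<open>n \<ge> j\<close> in auto)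
    then have "(\<lambda>n. s n \<bullet> e j) \<longlonglongrightarrow> (if j \<in> S then ?c j else 0)"
      by (intro tendsto_eventually eventually_sequentiallyI[of j])
    with limit_inner show ?thesis by (rule LIMSEQ_unique)
  qed
  then show ?thesis by blast
qed

section \<open>Blocks of indices and lacunary data\<close>

lemma energy_summable:
  assumes "orthonormal_basis e" "u0 \<in> dom_sqrt e lam"
  shows "(\<lambda>i. (u1 \<bullet> e i)\<^sup>2 + (lam i)\<^sup>2 * (u0 \<bullet> e i)\<^sup>2) summable_on {1..}"
  using assms fourier_coefficients_square_summable[of e u1]
  by (intro summable_on_add) (auto simp: orthonormal_basis_def dom_sqrt_def)

lemma rapid_cut_points:
  assumes "orthonormal_basis e" "u0 \<in> dom_sqrt e lam"
  shows "\<exists>f. strict_mono f \<and> (\<forall>n. f n \<ge> 1 \<and>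
    remainder e lam (f (Suc n)) u0 u1 * ((real (f n))\<^sup>2 * exp (real (f n) * lam (f n))) \<le> 1)"
proof -
  let ?c = "\<lambda>k. (real k)\<^sup>2 * exp (real k * lam k)"
  have "\<exists>f. \<forall>n. f n \<ge> 1 \<and> (f n < f (Suc n) \<and> remainder e lam (f (Suc n)) u0 u1 * ?c (f n) \<le> 1)"
  proof (rule dependent_nat_choice)
    fix k :: nat assume "k \<ge> 1"
    then have pos: "0 < ?c k" by simp
    then have "0 < 1 / ?c k" by (rule divide_pos_pos[OF zero_less_one])
    then obtain m where "\<And>l. l \<ge> m \<Longrightarrow> remainder e lam l u0 u1 \<le> 1 / ?c k"
      using infsum_tail_small[OF energy_summable[OF assms, of u1], of "1 / ?c k"]
      unfolding remainder_def by (auto simp del: zero_less_divide_iff)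
    then have "remainder e lam (max m (Suc k)) u0 u1 \<le> 1 / ?c k" by simp
    then have "remainder e lam (max m (Suc k)) u0 u1 * ?c k \<le> 1"
      using pos by (simp only: pos_le_divide_eq)
    then show "\<exists>l\<ge>1. k < l \<and> remainder e lam l u0 u1 * ?c k \<le> 1"
      by (intro exI[of _ "max m (Suc k)"]) auto
  qed auto
  then show ?thesis by (auto simp: strict_mono_Suc_iff)
qed

text \<open>
  A gap of \<open>(v0, v1)\<close> at the \<open>n\<close>-th block lets its remainder at \<open>f n\<close> start only after
  \<open>f (Suc n)\<close>, and there it is dominated by the remainder of \<open>(u0, u1)\<close>.
\<close>

lemma SG_if_block_gaps:
  assumes onb: "orthonormal_basis e" and u0: "u0 \<in> dom_sqrt e lam"
    and f: "strict_mono f" "\<And>n. f n \<ge> 1"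
    and rapid: "\<And>n. remainder e lam (f (Suc n)) u0 u1 *
      ((real (f n))\<^sup>2 * exp (real (f n) * lam (f n))) \<le> 1"
    and v: "\<And>i. i \<ge> 1 \<Longrightarrow> v0 \<bullet> e i = (if i \<in> S then u0 \<bullet> e i else 0)"
      "\<And>i. i \<ge> 1 \<Longrightarrow> v1 \<bullet> e i = (if i \<in> S then u1 \<bullet> e i else 0)"
    and N: "infinite N" "\<And>n. n \<in> N \<Longrightarrow> S \<inter> {f n<..f (Suc n)} = {}"
  shows "(v0, v1) \<in> SG e lam"
proof -
  have v0: "v0 \<in> dom_sqrt e lam"
    using u0 unfolding dom_sqrt_def
    by (auto elim!: summable_on_comparison_test simp: v)
  let ?u = "\<lambda>i. (u1 \<bullet> e i)\<^sup>2 + (lam i)\<^sup>2 * (u0 \<bullet> e i)\<^sup>2"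
  let ?v = "\<lambda>i. (v1 \<bullet> e i)\<^sup>2 + (lam i)\<^sup>2 * (v0 \<bullet> e i)\<^sup>2"
  note su = energy_summable[OF onb u0, of u1] and sv = energy_summable[OF onb v0, of v1]
  have bound: "remainder e lam (f n) v0 v1 * ((real (f n))\<^sup>2 * exp (real (f n) * lam (f n))) \<le> 1"
    if "n \<in> N" for n
  proof -
    have "remainder e lam (f n) v0 v1 \<le> remainder e lam (f (Suc n)) u0 u1"
      unfolding remainder_def
    proof (rule infsum_mono_neutral)
      show "?v summable_on {f n + 1..}" "?u summable_on {f (Suc n) + 1..}"
        by (auto intro: summable_on_subset_banach[OF sv] summable_on_subset_banach[OF su])
      show "?v i \<le> 0" if i: "i \<in> {f n + 1..} - {f (Suc n) + 1..}" for i
      proof -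
        have "i \<in> {f n<..f (Suc n)}" using i by auto
        then have "i \<notin> S" using N(2)[OF \<open>n \<in> N\<close>] by blast
        then show ?thesis using i by (simp add: v)
      qed
    qed (auto simp: v)
    then have "remainder e lam (f n) v0 v1 * ((real (f n))\<^sup>2 * exp (real (f n) * lam (f n)))
      \<le> remainder e lam (f (Suc n)) u0 u1 * ((real (f n))\<^sup>2 * exp (real (f n) * lam (f n)))"
      by (rule mult_right_mono) simp
    then show ?thesis using rapid[of n] by linarith
  qed
  have "infinite (f ` N)"
    using N(1) f(1) by (simp add: finite_image_iff strict_mono_imp_inj_on)
  moreover have "f ` N \<subseteq> {k. k \<ge> 1 \<and>
      remainder e lam k v0 v1 * ((real k)\<^sup>2 * exp (real k * lam k)) \<le> 1}"
    using bound f(2) by auto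
  ultimately show ?thesis
    using v0 unfolding SG_def by (auto dest: finite_subset)
qed

lemma block_index_unique:
  fixes f :: "nat \<Rightarrow> nat"
  assumes "strict_mono f" "i \<in> {f m<..f (Suc m)}" "i \<in> {f n<..f (Suc n)}"
  shows "m = n"
proof -
  have "f m < f (Suc n)" "f n < f (Suc m)" using assms(2,3) by auto
  then have "m < Suc n" "n < Suc m" using strict_mono_less[OF assms(1)] by blast+
  then show ?thesis by simp
qed

theorem proposition2p3:
  fixes D :: "'a::{real_inner, complete_space} set"
    and A :: "'a \<Rightarrow> 'a"
    and e :: "nat \<Rightarrow> 'a"
    and lam :: "nat \<Rightarrow> real"
    and u0 u1 :: 'a
  assumes "selfadjoint_op D A"
    and "orthonormal_basis e"
    and "\<forall>i\<ge>1. lam i > 0"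
    and "mono_on {1..} lam"
    and "filterlim lam at_top sequentially"
    and "\<forall>i\<ge>1. e i \<in> D \<and> A (e i) = (lam i)\<^sup>2 *\<^sub>R e i"
    and "u0 \<in> dom_sqrt e lam"
  shows "\<exists>v0 v1 w0 w1. (v0, v1) \<in> SG e lam \<and> (w0, w1) \<in> SG e lam \<and>
           u0 = v0 + w0 \<and> u1 = v1 + w1"
proof -
  note onb = \<open>orthonormal_basis e\<close> and u0 = \<open>u0 \<in> dom_sqrt e lam\<close>
  then have on: "\<And>i j. i \<ge> 1 \<Longrightarrow> j \<ge> 1 \<Longrightarrow> e i \<bullet> e j = (if i = j then 1 else 0)"
    by (simp add: orthonormal_basis_def)
  obtain f where f: "strict_mono f" "\<And>n. f n \<ge> 1"
    and rapid: "\<And>n. remainder e lam (f (Suc n)) u0 u1 *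
      ((real (f n))\<^sup>2 * exp (real (f n) * lam (f n))) \<le> 1"
    using rapid_cut_points[OF onb u0] by blast
  define S where "S = (\<Union>n\<in>{n. even n}. {f n<..f (Suc n)})"
  obtain v0 where v0: "\<And>i. i \<ge> 1 \<Longrightarrow> v0 \<bullet> e i = (if i \<in> S then u0 \<bullet> e i else 0)"
    using coefficient_truncation_exists[OF on] by blast
  obtain v1 where v1: "\<And>i. i \<ge> 1 \<Longrightarrow> v1 \<bullet> e i = (if i \<in> S then u1 \<bullet> e i else 0)"
    using coefficient_truncation_exists[OF on] by blast
  have "(v0, v1) \<in> SG e lam"
  proof (rule SG_if_block_gaps[OF onb u0 f rapid v0 v1])
    show "infinite {n::nat. odd n}"
      unfolding infinite_nat_iff_unbounded
    proof
      show "\<exists>n>m. n \<in> {n::nat. odd n}" for m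
        by (rule exI[of _ "2 * m + 1"]) simp
    qed
    show "S \<inter> {f n<..f (Suc n)} = {}" if "n \<in> {n. odd n}" for n
      using that block_index_unique[OF f(1)] unfolding S_def by blast
  qed
  moreover have "(u0 - v0, u1 - v1) \<in> SG e lam"
  proof (rule SG_if_block_gaps[OF onb u0 f rapid])
    show "(u0 - v0) \<bullet> e i = (if i \<in> - S then u0 \<bullet> e i else 0)"
      "(u1 - v1) \<bullet> e i = (if i \<in> - S then u1 \<bullet> e i else 0)" if "i \<ge> 1" for i
      using that by (simp_all add: inner_diff_left v0 v1)
    show "infinite {n::nat. even n}"
      unfolding infinite_nat_iff_unbounded
    proof
      show "\<exists>n>m. n \<in> {n::nat. even n}" for m
        by (rule exI[of _ "2 * m + 2"]) simp
    qed
    show "- S \<inter> {f n<..f (Suc n)} = {}" if "n \<in> {n. even n}" for n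
      using that unfolding S_def by blast
  qed
  ultimately show ?thesis
    by (intro exI[of _ v0] exI[of _ v1] exI[of _ "u0 - v0"] exI[of _ "u1 - v1"]) simp
qed

end
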